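(* Suppose a complete displayed sub-sum $F=f_1^2+\cdots+f_s^2$ has a shorter SOS representation $F=g_1^2+\cdots+g_r^2$ with $g_1,\dots,g_r$ real bilinear forms and $r<s$. Then every larger displayed decomposition containing the complete displayed squares $f_1^2,\dots,f_s^2$ is reducible. Moreover, if a displayed decomposition with $R$ squares contains $q$ such sub-sums that share no displayed square, each of which can be rewritten with at least one square fewer, then the total SOS length can be reduced by at least $q$: the polynomial defined by the decomposition is a sum of at most $R-q$ squares of real bilinear forms.
   Context: Real variables $x_1,\dots,x_m$, $y_1,\dots,y_n$ are fixed; a bilinear form is a real linear combination of the monomials $x_iy_j$. A displayed decomposition is a written sum $P=f_1^2+\cdots+f_R^2$ of squares of real bilinear forms (in the paper, each $f_t$ is a cell monomial $x_iy_j$ or a sum $x_iy_j+x_ky_\ell$ of two cell monomials, the forms having pairwise disjoint supports); $R$ is its number of displayed squares. A complete displayed sub-sum is the sum of a subcollection of the displayed squares. The decomposition is reducible if $P$ can be written as a sum of fewer than $R$ squares of real bilinear forms. *)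

theory Defs
  imports Complex_Main "HOL-Library.Poly_Mapping" "HOL-Library.Multiset" "HOL-Library.Disjoint_Sets"
begin

text \<open>
  Real polynomials in the variables $x_i$, $y_j$: finitely supported maps from monomials
  (exponent vectors) to coefficients, with the convolution product of \<^theory>\<open>HOL-Library.Poly_Mapping\<close>.
  Only the indices $1 \le i \le m$ and $1 \le j \le n$ are admitted in the bilinear forms below.
\<close>

datatype var = X nat | Y nat

type_synonym rpoly = "(var \<Rightarrow>\<^sub>0 nat) \<Rightarrow>\<^sub>0 real"

definition const_poly :: "real \<Rightarrow> rpoly" where
  "const_poly c = Poly_Mapping.single 0 c"

definition var_poly :: "var \<Rightarrow> rpoly" where
  "var_poly v = Poly_Mapping.single (Poly_Mapping.single v 1) 1"

definition bilinear_form :: "nat \<Rightarrow> nat \<Rightarrow> rpoly \<Rightarrow> bool" where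
  "bilinear_form m n f \<longleftrightarrow>
     (\<exists>c :: nat \<Rightarrow> nat \<Rightarrow> real.
        f = (\<Sum>i = 1..m. \<Sum>j = 1..n. const_poly (c i j) * (var_poly (X i) * var_poly (Y j))))"

text \<open>
  A displayed decomposition is the list of the forms being squared, so that the same square may be
  displayed more than once; the number of displayed squares is the length of the list.
  The forms are arbitrary bilinear forms: they need not be sums of one or two cell monomials
  with pairwise disjoint supports.
\<close>

definition displayed_decomposition :: "nat \<Rightarrow> nat \<Rightarrow> rpoly \<Rightarrow> rpoly list \<Rightarrow> bool" where
  "displayed_decomposition m n P fs \<longleftrightarrow>
     (\<forall>f \<in> set fs. bilinear_form m n f) \<and> P = (\<Sum>f\<leftarrow>fs. f ^ 2)"

definition sum_of_bilinear_squares :: "nat \<Rightarrow> nat \<Rightarrow> nat \<Rightarrow> rpoly \<Rightarrow> bool" where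
  "sum_of_bilinear_squares m n r P \<longleftrightarrow>
     (\<exists>g :: nat \<Rightarrow> rpoly. (\<forall>t < r. bilinear_form m n (g t)) \<and> P = (\<Sum>t<r. g t ^ 2))"

definition reducible :: "nat \<Rightarrow> nat \<Rightarrow> rpoly \<Rightarrow> rpoly list \<Rightarrow> bool" where
  "reducible m n P fs \<longleftrightarrow> (\<exists>r < length fs. sum_of_bilinear_squares m n r P)"

text \<open>
  A subcollection of the displayed squares is a set \<open>S\<close> of positions in the list (counted from 0),
  so it consists of \<open>card S\<close> displayed squares, and subcollections share no displayed square
  exactly when their position sets are disjoint.
\<close>

definition sub_sum :: "rpoly list \<Rightarrow> nat set \<Rightarrow> rpoly" where
  "sub_sum fs S = (\<Sum>t\<in>S. (fs ! t) ^ 2)"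

definition shortenable_sub_sum :: "nat \<Rightarrow> nat \<Rightarrow> rpoly list \<Rightarrow> nat set \<Rightarrow> bool" where
  "shortenable_sub_sum m n fs S \<longleftrightarrow>
     S \<subseteq> {..<length fs} \<and> (\<exists>r < card S. sum_of_bilinear_squares m n r (sub_sum fs S))"

text \<open>
  The squares displayed at the positions \<open>S\<close> of \<open>fs\<close> all occur, with multiplicity,
  among the squares displayed by \<open>hs\<close>.
\<close>

definition contains_squares :: "rpoly list \<Rightarrow> rpoly list \<Rightarrow> nat set \<Rightarrow> bool" where
  "contains_squares hs fs S \<longleftrightarrow>
     image_mset (\<lambda>t. (fs ! t) ^ 2) (mset_set S) \<subseteq># mset (map (\<lambda>h. h ^ 2) hs)"

end

theory Submission imports Defs begin

text \<open>Lengths of SOS representations add when polynomials are added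
  (\<open>sum_of_bilinear_squares_add\<close>), so a rewriting can be done locally. Split the
  displayed sum into the squares to be replaced and the rest; use the shorter representations on the
  former, and let each remaining square count as itself. One shortened sub-sum makes the total
  strictly shorter, and \<open>q\<close> disjoint ones save at least one square each. The two parts
  differ in how the rest is described: as a multiset of squares when another list contains the
  sub-sum (\<open>sum_of_bilinear_squares_sum_mset\<close>), as a set of positions when everything
  lives in one list (\<open>sum_of_bilinear_squares_sub_sum\<close>).\<close>

lemma sum_of_bilinear_squares_0: "sum_of_bilinear_squares m n 0 0"
  by (simp add: sum_of_bilinear_squares_def)

lemma sum_of_bilinear_squares_power2:
  assumes "bilinear_form m n f"
  shows "sum_of_bilinear_squares m n 1 (f ^ 2)"
  unfolding sum_of_bilinear_squares_def using assms by (intro exI[of _ "\<lambda>_. f"]) simp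

lemma sum_of_bilinear_squares_add:
  assumes "sum_of_bilinear_squares m n r P" "sum_of_bilinear_squares m n s Q"
  shows "sum_of_bilinear_squares m n (r + s) (P + Q)"
proof -
  obtain g where g: "\<And>t. t < r \<Longrightarrow> bilinear_form m n (g t)" "P = (\<Sum>t<r. g t ^ 2)"
    using assms(1) unfolding sum_of_bilinear_squares_def by blast
  obtain h where h: "\<And>t. t < s \<Longrightarrow> bilinear_form m n (h t)" "Q = (\<Sum>t<s. h t ^ 2)"
    using assms(2) unfolding sum_of_bilinear_squares_def by blast
  \<comment> \<open>Concatenate the two families, shifting the second by \<open>r\<close>.\<close>
  define k where "k t = (if t < r then g t else h (t - r))" for t
  have "(\<Sum>t<r + s. k t ^ 2) = (\<Sum>t<r. k t ^ 2) + (\<Sum>t<s. k (r + t) ^ 2)"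
    by (induction s) (simp_all add: add.assoc)
  also have "\<dots> = P + Q"
    by (simp add: k_def g h)
  finally have "P + Q = (\<Sum>t<r + s. k t ^ 2)" ..
  moreover have "\<forall>t<r + s. bilinear_form m n (k t)"
    using g(1) h(1) by (auto simp: k_def)
  ultimately show ?thesis
    unfolding sum_of_bilinear_squares_def by blast
qed

lemma sum_of_bilinear_squares_sum:
  assumes "finite I" "\<And>i. i \<in> I \<Longrightarrow> sum_of_bilinear_squares m n (r i) (P i)"
  shows "sum_of_bilinear_squares m n (\<Sum>i\<in>I. r i) (\<Sum>i\<in>I. P i)"
  using assms
  by (induction I rule: finite_induct)
     (simp_all add: sum_of_bilinear_squares_0 sum_of_bilinear_squares_add)

text \<open>Multiset containment gives only the values of the leftover squares, so a bilinear root
  is required for each of them.\<close>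

lemma sum_of_bilinear_squares_sum_mset:
  assumes "\<And>p. p \<in># N \<Longrightarrow> \<exists>f. bilinear_form m n f \<and> p = f ^ 2"
  shows "sum_of_bilinear_squares m n (size N) (\<Sum>\<^sub># N)"
  using assms
proof (induction N)
  case empty
  show ?case by (simp add: sum_of_bilinear_squares_0)
next
  case (add p N)
  then have "sum_of_bilinear_squares m n 1 p"
    using sum_of_bilinear_squares_power2 by fastforce
  with add show ?case
    using sum_of_bilinear_squares_add[of m n 1 p "size N" "\<Sum>\<^sub># N"] by simp
qed

lemma sum_of_bilinear_squares_sub_sum:
  assumes "\<forall>f \<in> set fs. bilinear_form m n f" "S \<subseteq> {..<length fs}"
  shows "sum_of_bilinear_squares m n (card S) (sub_sum fs S)"
proof -
  have "sum_of_bilinear_squares m n (\<Sum>t\<in>S. 1) (\<Sum>t\<in>S. (fs ! t) ^ 2)"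
    using assms
    by (intro sum_of_bilinear_squares_sum sum_of_bilinear_squares_power2)
       (auto intro: finite_subset nth_mem)
  then show ?thesis
    by (simp add: sub_sum_def)
qed

lemma displayed_decomposition_eq_sub_sum:
  assumes "displayed_decomposition m n P fs"
  shows "P = sub_sum fs {..<length fs}"
  using assms
  by (simp add: displayed_decomposition_def sub_sum_def sum_list_sum_nth atLeast0LessThan)

lemma reducible_if_contains_shortenable:
  assumes "shortenable_sub_sum m n fs S" "displayed_decomposition m n Q hs"
    "contains_squares hs fs S"
  shows "reducible m n Q hs"
proof -
  obtain r where r: "r < card S" "sum_of_bilinear_squares m n r (sub_sum fs S)"
    using assms(1) unfolding shortenable_sub_sum_def by blast
  define M where "M = image_mset (\<lambda>t. (fs ! t) ^ 2) (mset_set S)"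
  \<comment> \<open>\<open>N\<close> collects, with multiplicity, the squares of \<open>hs\<close>
    left untouched.\<close>
  obtain N where N: "mset (map (\<lambda>h. h ^ 2) hs) = M + N"
    using assms(3) unfolding contains_squares_def M_def[symmetric]
    by (auto simp: subset_mset.le_iff_add)
  have "Q = \<Sum>\<^sub># (mset (map (\<lambda>h. h ^ 2) hs))"
    using assms(2) unfolding displayed_decomposition_def by (simp only: sum_mset_sum_list)
  also have "\<dots> = sub_sum fs S + \<Sum>\<^sub># N"
    unfolding N by (simp add: M_def sub_sum_def sum_unfold_sum_mset)
  finally have Q: "Q = sub_sum fs S + \<Sum>\<^sub># N" .
  have "length hs = size (M + N)"
    unfolding N[symmetric] by simp
  then have len: "length hs = card S + size N"
    by (simp add: M_def)
  have "\<exists>f. bilinear_form m n f \<and> p = f ^ 2" if "p \<in># N" for p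
  proof -
    have "p \<in># mset (map (\<lambda>h. h ^ 2) hs)"
      unfolding N using that by simp
    then show ?thesis
      using assms(2) by (auto simp: displayed_decomposition_def)
  qed
  then have "sum_of_bilinear_squares m n (r + size N) Q"
    unfolding Q by (intro sum_of_bilinear_squares_add r(2) sum_of_bilinear_squares_sum_mset)
  \<comment> \<open>Since \<open>r < card S\<close>, the new length \<open>r + size N\<close> is
    below \<open>card S + size N = length hs\<close>.\<close>
  then show ?thesis
    using r(1) len unfolding reducible_def by (intro exI[of _ "r + size N"]) simp
qed

lemma shorten_disjoint_sub_sums:
  assumes "displayed_decomposition m n P fs"
    and "\<And>k. k < q \<Longrightarrow> shortenable_sub_sum m n fs (A k)"
    and "disjoint_family_on A {..<q}"
  shows "\<exists>r. r + q \<le> length fs \<and> sum_of_bilinear_squares m n r P"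
proof -
  define U where "U = (\<Union>k<q. A k)"
  define V where "V = {..<length fs} - U"
  have "\<forall>k\<in>{..<q}. \<exists>r. r < card (A k) \<and> sum_of_bilinear_squares m n r (sub_sum fs (A k))"
    using assms(2) unfolding shortenable_sub_sum_def by blast
  then obtain r where r: "\<And>k. k < q \<Longrightarrow> r k < card (A k)"
    "\<And>k. k < q \<Longrightarrow> sum_of_bilinear_squares m n (r k) (sub_sum fs (A k))"
    by (metis lessThan_iff)
  have sub: "A k \<subseteq> {..<length fs}" if "k < q" for k
    using assms(2)[OF that] by (simp add: shortenable_sub_sum_def)
  then have fin: "\<forall>k\<in>{..<q}. finite (A k)"
    using finite_subset by blast
  have disj: "\<forall>i\<in>{..<q}. \<forall>j\<in>{..<q}. i \<noteq> j \<longrightarrow> A i \<inter> A j = {}"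
    using assms(3) by (simp add: disjoint_family_on_def)
  have U: "U \<subseteq> {..<length fs}"
    using sub by (auto simp: U_def)
  \<comment> \<open>The positions split into \<open>V\<close> and \<open>U\<close>, and disjointness
    splits the sum over \<open>U\<close> further into the sums over the \<open>A k\<close>.\<close>
  have P: "P = sub_sum fs V + (\<Sum>k<q. sub_sum fs (A k))"
    using sum.subset_diff[OF U, of "\<lambda>t. (fs ! t) ^ 2"]
      sum.UNION_disjoint[OF _ fin disj, of "\<lambda>t. (fs ! t) ^ 2"]
    unfolding displayed_decomposition_eq_sub_sum[OF assms(1)]
    by (simp add: sub_sum_def U_def V_def)
  have "sum_of_bilinear_squares m n (card V + (\<Sum>k<q. r k)) P"
    unfolding P using assms(1) r(2)
    by (intro sum_of_bilinear_squares_add sum_of_bilinear_squares_sum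
          sum_of_bilinear_squares_sub_sum)
       (auto simp: displayed_decomposition_def V_def)
  moreover have "card V + (\<Sum>k<q. r k) + q \<le> length fs"
  proof -
    \<comment> \<open>Spread \<open>q\<close> as one unit per index: \<open>r k < card (A k)\<close>
      leaves room for exactly that unit.\<close>
    have "(\<Sum>k<q. r k) + q = (\<Sum>k<q. Suc (r k))"
      by (simp add: sum_Suc)
    also have "\<dots> \<le> (\<Sum>k<q. card (A k))"
      using r(1) by (intro sum_mono) (simp add: Suc_le_eq)
    also have "\<dots> = card U"
      unfolding U_def using card_UN_disjoint[OF _ fin disj] by simp
    \<comment> \<open>Not a further link of the chain, which ends at \<open>card U\<close>, but a
      separate count to be combined with it.\<close>
    also have "card V + card U = length fs"
      using U card_mono[OF _ U] by (simp add: V_def card_Diff_subset finite_subset)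
    ultimately show ?thesis by linarith
  qed
  ultimately show ?thesis by blast
qed

theorem proposition5p6:
  fixes m n :: nat
  shows "(\<forall>P fs S Q hs.
            displayed_decomposition m n P fs \<and> shortenable_sub_sum m n fs S \<and>
            displayed_decomposition m n Q hs \<and> contains_squares hs fs S
              \<longrightarrow> reducible m n Q hs) \<and>
         (\<forall>P fs q (A :: nat \<Rightarrow> nat set).
            displayed_decomposition m n P fs \<and>
            (\<forall>k < q. shortenable_sub_sum m n fs (A k)) \<and> disjoint_family_on A {..<q}
              \<longrightarrow> (\<exists>r. r + q \<le> length fs \<and> sum_of_bilinear_squares m n r P))"
  using reducible_if_contains_shortenable shorten_disjoint_sub_sums by blast

end
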